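(* Let $A$ be an Archimedean infinitesimal-free proper $*$-ring and let $(S,E)$ be a Weyl $*$-semigroup where $S$ is a $*$-subsemigroup of (the multiplicative $*$-semigroup of) $A$ lying in the unit ball $A^1=\{a\in A:\|a\|\le1\}$. For $a\in S$ let $\mathcal{C}_a=\{C\in\mathcal{C}(S):a\in C\}$, where $\mathcal{C}(S)$ is the coset groupoid of $S$. Then for any $a,b\in S$, \[\mathcal{C}_{ab}=\mathcal{C}_a\mathcal{C}_b.\]
   Context: A $*$-ring is an associative, not necessarily unital, ring $A$ with an additive map $a\mapsto a^*$ satisfying $a^{**}=a$, $(ab)^*=b^*a^*$. $\mathbb{N}$ denotes the positive integers. For $B\subseteq A$, $|B|^2=\{b^*b:b\in B\}$ and $B_\Sigma=\{p_1+\cdots+p_k:k\ge1,\ p_1,\dots,p_k\in|B|^2\}$. For $a\in A$, with $\inf\emptyset=\infty$ and $\vee$ denoting maximum, \[\lceil a\rceil=\sup_{b\in A}\inf\{m/n:m,n\in\mathbb{N},\ mbb^*-nbab^*\in A_\Sigma\}\in[0,\infty],\qquad\|a\|=\sqrt{\lceil aa^*\rceil\vee\lceil a^*a\rceil}.\] $A$ is Archimedean if $\lceil-a\rceil=0$ implies $\lceil a\rceil<\infty$; infinitesimal-free if $\lceil a\rceil=\lceil-a\rceil=0$ implies $a=0$; proper if $aa^*=0$ implies $a=0$ (for all $a\in A$). For $T,U\subseteq S$: $TU=\{tu:t\in T,u\in U\}$, $T^*=\{t^*:t\in T\}$. $(S,E)$ being a Weyl $*$-semigroup means $E\subseteq S$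 satisfies $EE\subseteq E=E^*$, $a^*Ea\subseteq E$ for all $a\in S$, and for every $a\in S$ the element $a^*a$ lies in $E$ and commutes with every element of $E$. For $a,b\in S$: $a\precsim b$ iff $ab^*\in E$ and $a=ab^*b$. For $T\subseteq S$, $T^{\precsim}=\{a\in S:\exists t\in T\ (t\precsim a)\}$. A coset is a subset $C\subseteq S$ with $CC^*C\subseteq C=C^{\precsim}$. The set $\mathcal{C}(S)$ of non-empty cosets is a groupoid with inverse $C\mapsto C^*$ and product $(B,C)\mapsto(BC)^{\precsim}$, defined when $(B^*B)^{\precsim}=(CC^* )^{\precsim}$. $\mathcal{C}_a\mathcal{C}_b$ denotes the set of all defined products $(BC)^{\precsim}$ with $B\in\mathcal{C}_a$, $C\in\mathcal{C}_b$. *)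

theory Defs
  imports "HOL-Library.Extended_Nonnegative_Real" "HOL-Library.Set_Algebras"
begin

class star_semigroup = semigroup_mult +
  fixes star :: "'a \<Rightarrow> 'a"
  assumes star_star: "star (star a) = a"
    and star_mult: "star (a * b) = star b * star a"

text \<open>The class \<open>ring\<close> does not postulate a unit.\<close>

class star_ring = ring + star_semigroup +
  assumes star_add: "star (a + b) = star a + star b"

definition abs_squares :: "'a::star_semigroup set \<Rightarrow> 'a set" where
  "abs_squares B = {star b * b | b. b \<in> B}"

definition sums_of_squares :: "'a::star_ring set \<Rightarrow> 'a set" where
  "sums_of_squares B = {sum_list ps | ps. ps \<noteq> [] \<and> set ps \<subseteq> abs_squares B}"

text \<open>The integer multiple \<open>n a\<close>; without a unit, \<open>of_nat n\<close> is not available.\<close>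

definition nmult :: "nat \<Rightarrow> 'a::comm_monoid_add \<Rightarrow> 'a" where
  "nmult n a = (\<Sum>_<n. a)"

text \<open>Both bounds are taken in the complete lattice \<open>[0,\<infinity>]\<close>, so the infimum of the empty set
  is \<open>\<infinity>\<close>.\<close>

definition star_ceil :: "'a::star_ring \<Rightarrow> ennreal" where
  "star_ceil a =
    (SUP b. Inf {ennreal (real m / real n) | m n.
       0 < m \<and> 0 < n \<and>
       nmult m (b * star b) - nmult n (b * a * star b) \<in> sums_of_squares UNIV})"

definition ennreal_sqrt :: "ennreal \<Rightarrow> ennreal" where
  "ennreal_sqrt x = (if x = \<infinity> then \<infinity> else ennreal (sqrt (enn2real x)))"

definition star_norm :: "'a::star_ring \<Rightarrow> ennreal" where
  "star_norm a = ennreal_sqrt (max (star_ceil (a * star a)) (star_ceil (star a * a)))"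

definition star_unit_ball :: "'a::star_ring set" where
  "star_unit_ball = {a. star_norm a \<le> 1}"

definition star_archimedean :: "'a::star_ring itself \<Rightarrow> bool" where
  "star_archimedean _ \<longleftrightarrow> (\<forall>a::'a. star_ceil (- a) = 0 \<longrightarrow> star_ceil a < \<infinity>)"

definition star_infinitesimal_free :: "'a::star_ring itself \<Rightarrow> bool" where
  "star_infinitesimal_free _ \<longleftrightarrow> (\<forall>a::'a. star_ceil a = 0 \<and> star_ceil (- a) = 0 \<longrightarrow> a = 0)"

definition star_proper :: "'a::star_ring itself \<Rightarrow> bool" where
  "star_proper _ \<longleftrightarrow> (\<forall>a::'a. a * star a = 0 \<longrightarrow> a = 0)"

definition star_subsemigroup :: "'a::star_semigroup set \<Rightarrow> bool" where
  "star_subsemigroup S \<longleftrightarrow> S * S \<subseteq> S \<and> star ` S \<subseteq> S"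

text \<open>The \<open>*\<close>-semigroup \<open>S\<close> is represented as a \<open>*\<close>-subsemigroup of the ambient type.\<close>

definition weyl_star_semigroup :: "'a::star_semigroup set \<Rightarrow> 'a set \<Rightarrow> bool" where
  "weyl_star_semigroup S E \<longleftrightarrow>
     star_subsemigroup S \<and> E \<subseteq> S \<and> E * E \<subseteq> E \<and> E = star ` E \<and>
     (\<forall>a\<in>S. {star a} * E * {a} \<subseteq> E) \<and>
     (\<forall>a\<in>S. star a * a \<in> E \<and> (\<forall>e\<in>E. star a * a * e = e * (star a * a)))"

definition weyl_prec :: "'a::star_semigroup set \<Rightarrow> 'a \<Rightarrow> 'a \<Rightarrow> bool" where
  "weyl_prec E a b \<longleftrightarrow> a * star b \<in> E \<and> a = a * star b * b"

definition up_closure :: "'a::star_semigroup set \<Rightarrow> 'a set \<Rightarrow> 'a set \<Rightarrow> 'a set" where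
  "up_closure S E T = {a \<in> S. \<exists>t\<in>T. weyl_prec E t a}"

definition is_coset :: "'a::star_semigroup set \<Rightarrow> 'a set \<Rightarrow> 'a set \<Rightarrow> bool" where
  "is_coset S E C \<longleftrightarrow> C \<subseteq> S \<and> C * star ` C * C \<subseteq> C \<and> C = up_closure S E C"

text \<open>The coset groupoid consists of the carrier \<open>cosets S E\<close>, the inverse \<open>C \<mapsto> star ` C\<close> and the
  partial product \<open>coset_mult S E\<close> with domain \<open>coset_composable S E\<close>.\<close>

definition cosets :: "'a::star_semigroup set \<Rightarrow> 'a set \<Rightarrow> 'a set set" where
  "cosets S E = {C. is_coset S E C \<and> C \<noteq> {}}"

definition coset_composable :: "'a::star_semigroup set \<Rightarrow> 'a set \<Rightarrow> 'a set \<Rightarrow> 'a set \<Rightarrow> bool" where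
  "coset_composable S E B C \<longleftrightarrow> up_closure S E (star ` B * B) = up_closure S E (C * star ` C)"

definition coset_mult :: "'a::star_semigroup set \<Rightarrow> 'a set \<Rightarrow> 'a set \<Rightarrow> 'a set \<Rightarrow> 'a set" where
  "coset_mult S E B C = up_closure S E (B * C)"

definition coset_set_mult ::
    "'a::star_semigroup set \<Rightarrow> 'a set \<Rightarrow> 'a set set \<Rightarrow> 'a set set \<Rightarrow> 'a set set" where
  "coset_set_mult S E X Y =
     {coset_mult S E B C | B C. B \<in> X \<and> C \<in> Y \<and> coset_composable S E B C}"

definition cosets_containing :: "'a::star_semigroup set \<Rightarrow> 'a set \<Rightarrow> 'a \<Rightarrow> 'a set set" where
  "cosets_containing S E a = {C \<in> cosets S E. a \<in> C}"

end

theory Submission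
  imports Defs
begin

text \<open>If \<open>B\<close> contains \<open>a\<close> and \<open>C\<close> contains \<open>b\<close>, then \<open>ab\<close> lies in \<open>BC \<subseteq> (BC)\<^sup>\<precsim>\<close>: every element of a
  coset has an element of that coset below it, and \<open>\<precsim>\<close> is compatible with products.  That \<open>(BC)\<^sup>\<precsim>\<close> is again a
  coset holds in every Weyl *-semigroup (\<open>is_coset_mult\<close>).

  Conversely, a coset \<open>C\<close> containing \<open>ab\<close> has to be factored.  It contains some \<open>c \<precsim> ab\<close>, so that
  \<open>cb\<^sup>*a\<^sup>*ab = c\<close>, and the candidates are \<open>(Cb\<^sup>*)\<^sup>\<precsim>\<close> and \<open>(bC\<^sup>*C)\<^sup>\<precsim>\<close>.  They work as soon as
  \<open>cb\<^sup>*b = c\<close> and \<open>cb\<^sup>* \<precsim> a\<close>: the first equation makes \<open>b\<^sup>*b\<close> cancel next to \<open>c\<^sup>*c\<close>, so that the product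
  of the candidates is \<open>C\<close> and the second one contains \<open>b\<close> (\<open>coset_split\<close>), and the second relation
  puts \<open>a\<close> into the first candidate.

  These two facts need the ring.  In the unit ball \<open>b\<^sup>*a\<^sup>*ab \<le> b\<^sup>*b \<le> 1\<close>, so where the first of these
  acts as the identity the second one is squeezed between \<open>1\<close> and \<open>1\<close>.  The inequalities hold only up
  to infinitesimals, and there is no unit to compare with; \<open>right_factor_acts_as_identity\<close> carries
  this argument out for \<open>zz\<^sup>*\<close> with \<open>z = c - cb\<^sup>*b\<close>, and \<open>prec_mult_right_cancel\<close> deduces both facts.\<close>

section \<open>The order given by sums of squares\<close>

lemma nmult_0 [simp]: "nmult 0 a = 0"
  by (simp add: nmult_def)

lemma nmult_Suc [simp]: "nmult (Suc n) a = nmult n a + a"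
  by (simp add: nmult_def)

lemma nmult_add_left: "nmult (m + n) a = nmult m a + nmult n a"
  by (induction n) (simp_all add: add.assoc)

lemma nmult_mult: "nmult (m * n) a = nmult m (nmult n a)"
  by (induction m) (simp_all add: nmult_add_left add.commute)

lemma nmult_zero_right [simp]: "nmult n 0 = 0"
  by (simp add: nmult_def)

lemma nmult_add_right: "nmult n (a + b) = nmult n a + nmult n b"
  by (simp add: nmult_def sum.distrib)

lemma nmult_diff_right: "nmult n (a - b) = nmult n a - nmult n (b::'a::ab_group_add)"
  by (simp add: nmult_def sum_subtractf)

lemma nmult_minus_right: "nmult n (- a) = - nmult n (a::'a::ab_group_add)"
  by (simp add: nmult_def sum_negf)

lemma star_0 [simp]: "star (0::'a::star_ring) = 0"
  using star_add [of "0::'a" 0] by simp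

lemma star_diff: "star (a - b) = star a - star (b::'a::star_ring)"
  using star_add [of "a - b" b] by simp

lemma square_in_sums_of_squares: "x * star x \<in> sums_of_squares (UNIV::'a::star_ring set)"
proof -
  have "x * star x = sum_list [star (star x) * star x]"
    by (simp add: star_star)
  moreover have "set [star (star x) * star x] \<subseteq> abs_squares UNIV"
    by (auto simp: abs_squares_def)
  ultimately show ?thesis
    unfolding sums_of_squares_def by blast
qed

lemma add_in_sums_of_squares:
  assumes "x \<in> sums_of_squares B" "y \<in> sums_of_squares B"
  shows "x + y \<in> sums_of_squares B"
proof -
  obtain ps qs where "x = sum_list ps" "ps \<noteq> []" "set ps \<subseteq> abs_squares B"
    "y = sum_list qs" "qs \<noteq> []" "set qs \<subseteq> abs_squares B"
    using assms unfolding sums_of_squares_def by auto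
  then have "x + y = sum_list (ps @ qs)" "ps @ qs \<noteq> []" "set (ps @ qs) \<subseteq> abs_squares B"
    by auto
  then show ?thesis
    unfolding sums_of_squares_def by blast
qed

lemma nmult_in_sums_of_squares:
  assumes "x \<in> sums_of_squares UNIV"
  shows "nmult n x \<in> sums_of_squares UNIV"
proof (induction n)
  case 0
  show ?case
    using square_in_sums_of_squares [of 0] by simp
next
  case (Suc n)
  then show ?case
    using assms by (simp add: add_in_sums_of_squares)
qed

text \<open>The ceiling only sees the quotient \<open>m/n\<close>, so common integer factors are cleared.  Whether
  \<open>m dd\<^sup>* - n dad\<^sup>*\<close> is nonnegative then depends on \<open>m/n\<close> only.\<close>

definition star_nonneg :: "'a::star_ring \<Rightarrow> bool" where
  "star_nonneg x \<longleftrightarrow> (\<exists>k>0. nmult k x \<in> sums_of_squares UNIV)"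

lemma star_nonnegI: "x \<in> sums_of_squares UNIV \<Longrightarrow> star_nonneg x"
  unfolding star_nonneg_def by (rule exI [of _ "Suc 0"]) simp

lemma star_nonneg_square: "star_nonneg (x * star x)"
  by (simp add: star_nonnegI square_in_sums_of_squares)

lemma star_nonneg_add:
  assumes "star_nonneg x" "star_nonneg y"
  shows "star_nonneg (x + y)"
proof -
  obtain k l where k: "k > 0" "nmult k x \<in> sums_of_squares UNIV"
    and l: "l > 0" "nmult l y \<in> sums_of_squares UNIV"
    using assms unfolding star_nonneg_def by blast
  have "nmult (k * l) (x + y) = nmult l (nmult k x) + nmult k (nmult l y)"
    by (simp add: nmult_add_right flip: nmult_mult) (simp add: mult.commute)
  then have "nmult (k * l) (x + y) \<in> sums_of_squares UNIV"
    using k l by (simp add: add_in_sums_of_squares nmult_in_sums_of_squares)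
  then show ?thesis
    using k l unfolding star_nonneg_def by (metis nat_0_less_mult_iff)
qed

lemma star_nonneg_nmult: "star_nonneg x \<Longrightarrow> star_nonneg (nmult n x)"
  unfolding star_nonneg_def
  by (metis mult.commute nmult_in_sums_of_squares nmult_mult)

lemma star_ceil_eq_0I:
  assumes M: "M > 0"
    and nonneg: "\<And>N d. star_nonneg (nmult M (d * star d) - nmult N (d * a * star d))"
  shows "star_ceil a = 0"
proof -
  have "Inf {ennreal (real m / real n) | m n. 0 < m \<and> 0 < n \<and>
       nmult m (b * star b) - nmult n (b * a * star b) \<in> sums_of_squares UNIV} = 0"
    (is "Inf ?X = 0") for b
  proof -
    have le: "Inf ?X \<le> ennreal (real M / real N)" if N: "N > 0" for N
    proof -
      obtain k where k: "k > 0"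
        "nmult k (nmult M (b * star b) - nmult N (b * a * star b)) \<in> sums_of_squares UNIV"
        using nonneg unfolding star_nonneg_def by blast
      have "nmult (k * M) (b * star b) - nmult (k * N) (b * a * star b) \<in> sums_of_squares UNIV"
        using k by (simp add: nmult_mult nmult_diff_right)
      moreover have "real M / real N = real (k * M) / real (k * N)"
        using k by simp
      moreover have "0 < k * M" "0 < k * N"
        using k M N by simp_all
      ultimately have "ennreal (real M / real N) \<in> ?X"
        by (metis (mono_tags, lifting) mem_Collect_eq)
      then show ?thesis
        by (rule Inf_lower)
    qed
    have "Inf ?X \<le> ennreal (real M / real (Suc N))" for N
      by (rule le) simp
    moreover have "(\<lambda>N. ennreal (real M / real (Suc N))) \<longlonglongrightarrow> ennreal 0"
      by (intro tendsto_ennrealI LIMSEQ_Suc lim_const_over_n)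
    ultimately have "Inf ?X \<le> ennreal 0"
      by (intro LIMSEQ_le_const) auto
    then show ?thesis
      by simp
  qed
  then show ?thesis
    unfolding star_ceil_def by simp
qed

text \<open>The infimum yields some fraction below \<open>(N + 1)/N\<close> rather than that fraction itself.  Enlarging
  it to \<open>(N + 1)/N\<close> adds a multiple of \<open>dd\<^sup>*\<close>, which is a sum of squares.\<close>

lemma star_ceil_le_1D:
  assumes ceil: "star_ceil a \<le> 1"
  shows "star_nonneg (nmult (Suc N) (d * star d) - nmult N (d * a * star d))"
proof (cases "N = 0")
  case True
  then show ?thesis
    by (simp add: star_nonneg_square)
next
  case False
  define X where "X = {ennreal (real m / real n) | m n. 0 < m \<and> 0 < n \<and>
       nmult m (d * star d) - nmult n (d * a * star d) \<in> sums_of_squares UNIV}"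
  have "Inf X \<le> star_ceil a"
    unfolding X_def star_ceil_def by (rule SUP_upper) simp
  also have "\<dots> < ennreal (real (Suc N) / real N)"
    using False by (intro le_less_trans [OF ceil]) simp
  finally obtain r where "r \<in> X" and r: "r < ennreal (real (Suc N) / real N)"
    unfolding Inf_less_iff by blast
  then obtain m n where n: "0 < n" and r_eq: "r = ennreal (real m / real n)"
    and mn: "nmult m (d * star d) - nmult n (d * a * star d) \<in> sums_of_squares UNIV"
    unfolding X_def by blast
  have "real m / real n < real (Suc N) / real N"
    using r by (simp add: r_eq ennreal_less_iff)
  then have "real (m * N) < real (n * Suc N)"
    using n False by (simp add: field_simps)
  then have le: "m * N \<le> n * Suc N"
    by linarith
  let ?P = "d * star d" and ?R = "d * a * star d"
  have "nmult n (nmult (Suc N) ?P - nmult N ?R)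
      = nmult (n * Suc N) ?P - nmult (n * N) ?R"
    by (simp only: nmult_diff_right nmult_mult)
  also have "nmult (n * Suc N) ?P = nmult (n * Suc N - m * N) ?P + nmult (m * N) ?P"
    using le by (simp flip: nmult_add_left)
  also have "\<dots> - nmult (n * N) ?R
      = nmult (n * Suc N - m * N) ?P + nmult N (nmult m ?P - nmult n ?R)"
    by (simp add: nmult_diff_right mult.commute flip: nmult_mult)
  also have "\<dots> \<in> sums_of_squares UNIV"
    using mn by (intro add_in_sums_of_squares nmult_in_sums_of_squares square_in_sums_of_squares)
  finally show ?thesis
    using n unfolding star_nonneg_def by blast
qed

lemma ennreal_sqrt_le_1D: "ennreal_sqrt x \<le> 1 \<Longrightarrow> x \<le> 1"
  by (cases x) (auto simp: ennreal_sqrt_def top_unique split: if_splits)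

lemma star_unit_ballD:
  assumes "a \<in> star_unit_ball"
  shows "star_ceil (a * star a) \<le> 1" and "star_ceil (star a * a) \<le> 1"
  using assms ennreal_sqrt_le_1D unfolding star_unit_ball_def star_norm_def by fastforce+

text \<open>In a C*-algebra: \<open>b\<^sup>*b\<close> lies between \<open>b\<^sup>*a\<^sup>*ab\<close> and \<open>1\<close>, so it acts as the identity wherever
  \<open>b\<^sup>*a\<^sup>*ab\<close> does.  Here, put \<open>z = c - cb\<^sup>*b\<close> and expand
  \<open>zz\<^sup>* = cc\<^sup>* - 2cb\<^sup>*bc\<^sup>* + cb\<^sup>*(bb\<^sup>*)bc\<^sup>*\<close>.  The first term equals \<open>cb\<^sup>*(a\<^sup>*a)bc\<^sup>*\<close>, and both it
  and the last one are bounded by \<open>cb\<^sup>*bc\<^sup>*\<close> up to an arbitrarily small multiple of \<open>cb\<^sup>*bc\<^sup>*\<close>.  This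
  element is itself bounded by an integer, as \<open>b\<close> and \<open>c\<close> are in the unit ball.
  Hence \<open>zz\<^sup>*\<close> is infinitesimal, and \<open>z = 0\<close> by properness.\<close>

lemma right_factor_acts_as_identity:
  fixes a b c :: "'a::star_ring"
  assumes free: "star_infinitesimal_free TYPE('a)" and proper: "star_proper TYPE('a)"
    and ball: "a \<in> star_unit_ball" "b \<in> star_unit_ball" "c \<in> star_unit_ball"
    and c: "c * star b * star a * a * b = c"
  shows "c * star b * b = c"
proof -
  define z where "z = c - c * star b * b"
  have c_absorb: "c * (star b * (star a * (a * (b * t)))) = c * t" for t
    using arg_cong [OF c, of "\<lambda>x. x * t"] by (simp add: mult.assoc)
  have "star_ceil (z * star z) = 0"
  proof (rule star_ceil_eq_0I)
    fix N and d :: 'a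
    let ?D = "d * c * star b"
    define P where "P = d * star d"
    define Q where "Q = d * c * star c * star d"
    define R where "R = d * c * star b * b * star c * star d"
    define V where "V = d * c * star b * b * star b * b * star c * star d"
    have Q_le_P: "star_nonneg (nmult 2 P - Q)"
      using star_ceil_le_1D [OF star_unit_ballD(1) [OF ball(3)], of 1 d]
      by (simp add: P_def Q_def mult.assoc numeral_2_eq_2)
    have R_le_Q: "star_nonneg (nmult 2 Q - R)"
      using star_ceil_le_1D [OF star_unit_ballD(2) [OF ball(2)], of 1 "d * c"]
      by (simp add: Q_def R_def mult.assoc star_mult numeral_2_eq_2)
    have Q_le_R: "star_nonneg (nmult (Suc N) R - nmult N Q)"
    proof -
      have "?D * star ?D = R" "?D * (star a * a) * star ?D = Q"
        by (simp_all add: Q_def R_def mult.assoc star_mult star_star c_absorb)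
      then show ?thesis
        using star_ceil_le_1D [OF star_unit_ballD(2) [OF ball(1)], of N ?D] by simp
    qed
    have V_le_R: "star_nonneg (nmult (Suc N) R - nmult N V)"
    proof -
      have "?D * star ?D = R" "?D * (b * star b) * star ?D = V"
        by (simp_all add: V_def R_def mult.assoc star_mult star_star)
      then show ?thesis
        using star_ceil_le_1D [OF star_unit_ballD(1) [OF ball(2)], of N ?D] by simp
    qed
    \<comment> \<open>The error \<open>2R\<close> left by the last two bounds is absorbed by \<open>R \<le> 2Q\<close> and \<open>Q \<le> 2P\<close>, which gives \<open>8P\<close>.\<close>
    have expand: "d * (z * star z) * star d = Q - R - R + V"
      by (simp add: z_def star_diff star_mult star_star Q_def R_def V_def algebra_simps)
    have "nmult 8 P - nmult N (d * (z * star z) * star d)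
        = (nmult (Suc N) R - nmult N Q) + (nmult (Suc N) R - nmult N V)
          + nmult 2 (nmult 2 Q - R) + nmult 4 (nmult 2 P - Q)"
      unfolding expand
      by (simp add: nmult_diff_right nmult_add_right eval_nat_numeral algebra_simps)
    then show "star_nonneg (nmult 8 (d * star d) - nmult N (d * (z * star z) * star d))"
      unfolding P_def [symmetric]
      using Q_le_P R_le_Q Q_le_R V_le_R by (simp only: star_nonneg_add star_nonneg_nmult)
  qed simp
  moreover have "star_ceil (- (z * star z)) = 0"
  proof (rule star_ceil_eq_0I)
    fix N and d :: 'a
    have "nmult 1 (d * star d) - nmult N (d * - (z * star z) * star d)
        = d * star d + nmult N ((d * z) * star (d * z))"
      by (simp add: star_mult mult.assoc nmult_minus_right)
    then show "star_nonneg (nmult 1 (d * star d) - nmult N (d * - (z * star z) * star d))"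
      by (simp only: star_nonneg_add star_nonneg_nmult star_nonneg_square)
  qed simp
  ultimately have "z = 0"
    using free proper unfolding star_infinitesimal_free_def star_proper_def by blast
  then show ?thesis
    by (simp add: z_def)
qed

section \<open>The relation \<open>\<precsim>\<close> in a Weyl *-semigroup\<close>

locale weyl =
  fixes S E :: "'a::star_semigroup set"
  assumes weyl: "weyl_star_semigroup S E"
begin

abbreviation prec (infix "\<lesssim>" 50) where "prec \<equiv> weyl_prec E"
abbreviation up where "up \<equiv> up_closure S E"

lemma mult_S: "s \<in> S \<Longrightarrow> t \<in> S \<Longrightarrow> s * t \<in> S"
  using weyl set_times_intro [of s S t S]
  unfolding weyl_star_semigroup_def star_subsemigroup_def by (elim conjE) (rule subsetD)

lemma star_S: "s \<in> S \<Longrightarrow> star s \<in> S"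
  using weyl unfolding weyl_star_semigroup_def star_subsemigroup_def
  by (elim conjE) (rule subsetD, assumption, rule imageI)

lemma mult_E: "e \<in> E \<Longrightarrow> f \<in> E \<Longrightarrow> e * f \<in> E"
  using weyl set_times_intro [of e E f E]
  unfolding weyl_star_semigroup_def by (elim conjE) (rule subsetD)

lemma star_E:
  assumes "e \<in> E"
  shows "star e \<in> E"
proof -
  have "E = star ` E"
    using weyl unfolding weyl_star_semigroup_def by (elim conjE)
  then show ?thesis
    using assms by blast
qed

lemma star_conj_E:
  assumes "s \<in> S" "e \<in> E"
  shows "star s * e * s \<in> E"
proof -
  have "star s * e * s \<in> {star s} * E * {s}"
    using assms by (intro set_times_intro) auto
  moreover have "\<forall>s\<in>S. {star s} * E * {s} \<subseteq> E"
    using weyl unfolding weyl_star_semigroup_def by (elim conjE)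
  ultimately show ?thesis
    using assms by blast
qed

lemma conj_star_E: "s \<in> S \<Longrightarrow> e \<in> E \<Longrightarrow> s * e * star s \<in> E"
  using star_conj_E [of "star s" e] by (simp add: star_S star_star)

lemma star_mult_self_E: "s \<in> S \<Longrightarrow> star s * s \<in> E"
  using weyl unfolding weyl_star_semigroup_def by (elim conjE) simp

lemma star_mult_self_commute: "s \<in> S \<Longrightarrow> e \<in> E \<Longrightarrow> star s * s * e = e * (star s * s)"
  using weyl unfolding weyl_star_semigroup_def by (elim conjE) (simp add: mult.assoc)

lemma mult_star_self_commute: "s \<in> S \<Longrightarrow> e \<in> E \<Longrightarrow> s * star s * e = e * (s * star s)"
  using star_mult_self_commute [of "star s" e] by (simp add: star_S star_star)

lemma prec_absorb:
  assumes "s \<lesssim> t"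
  shows "s * (star t * t) = s" and "s * (star t * (t * x)) = s * x"
  using assms by (simp_all add: weyl_prec_def flip: mult.assoc)

lemma prec_trans:
  assumes rs: "r \<lesssim> s" and st: "s \<lesssim> t"
  shows "r \<lesssim> t"
proof -
  have "r * star t = (r * star s) * (s * star t)"
    by (simp add: mult.assoc prec_absorb [OF rs])
  then have "r * star t \<in> E"
    using mult_E rs st by (simp add: weyl_prec_def)
  moreover have "r * star t * t = r * (star s * (s * (star t * t)))"
    by (simp add: mult.assoc prec_absorb [OF rs])
  then have "r * star t * t = r"
    by (simp add: prec_absorb [OF rs] prec_absorb [OF st])
  ultimately show ?thesis
    by (simp add: weyl_prec_def)
qed

lemma prec_star:
  assumes t: "t \<in> S" and st: "s \<lesssim> t"
  shows "star s \<lesssim> star t"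
proof -
  have E: "s * star t \<in> E"
    using st by (simp add: weyl_prec_def)
  have "star (star t * (s * star t) * t) = star s * t"
    using prec_absorb(1) [OF st] by (simp add: star_mult star_star mult.assoc)
  then have "star s * t \<in> E"
    using star_E [OF star_conj_E [OF t E]] by simp
  moreover have "t * star t * s = t * star t * (s * star t) * t"
    by (simp add: mult.assoc prec_absorb [OF st])
  then have "t * star t * s = s * star t * (t * star t) * t"
    by (simp only: mult_star_self_commute [OF t E])
  then have tts: "t * star t * s = s"
    by (simp add: mult.assoc prec_absorb [OF st])
  have "star s * t * star t = star s"
    using arg_cong [OF tts, of star] by (simp add: star_mult star_star mult.assoc)
  ultimately show ?thesis
    by (simp add: weyl_prec_def star_star)
qed

text \<open>Since \<open>\<precsim>\<close> is not reflexive, some \<open>s \<precsim> t\<close> has to be given: \<open>te \<precsim> t\<close> fails in general.\<close>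

lemma prec_mult_E:
  assumes t: "t \<in> S" and st: "s \<lesssim> t" and e: "e \<in> E"
  shows "s * e \<lesssim> t"
proof -
  have "s * e * star t = (s * star t) * (t * e * star t)"
    by (simp add: mult.assoc prec_absorb [OF st])
  then have "s * e * star t \<in> E"
    using st mult_E conj_star_E t e by (simp add: weyl_prec_def)
  moreover have "s * e * star t * t = s * (e * (star t * t))"
    by (simp only: mult.assoc)
  then have "s * e * star t * t = s * (star t * t * e)"
    by (simp only: star_mult_self_commute [OF t e])
  then have "s * e * star t * t = s * e"
    by (simp add: mult.assoc prec_absorb [OF st])
  ultimately show ?thesis
    by (simp add: weyl_prec_def)
qed

lemma prec_mult:
  assumes t: "t \<in> S" and st: "s \<lesssim> t" and st': "s' \<lesssim> t'"
  shows "s * s' \<lesssim> t * t'"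
proof -
  have E: "s * star t \<in> E" "s' * star t' \<in> E"
    using st st' by (simp_all add: weyl_prec_def)
  have "s * s' * star (t * t') = (s * star t) * (t * (s' * star t') * star t)"
    by (simp add: star_mult mult.assoc prec_absorb [OF st])
  then have "s * s' * star (t * t') \<in> E"
    using mult_E conj_star_E E t by simp
  moreover have "s * s' * star (t * t') * (t * t') = s * (s' * star t' * (star t * t)) * t'"
    by (simp only: star_mult mult.assoc)
  then have "s * s' * star (t * t') * (t * t') = s * (star t * t * (s' * star t')) * t'"
    by (simp only: star_mult_self_commute [OF t E(2)])
  then have "s * s' * star (t * t') * (t * t') = s * s'"
    by (simp add: mult.assoc prec_absorb [OF st] prec_absorb [OF st'])
  ultimately show ?thesis
    by (simp add: weyl_prec_def)
qed

lemma prec_mult_star: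
  assumes "r \<in> S" "s \<in> S" "r' \<lesssim> r" "s' \<lesssim> s"
  shows "r' * star s' \<lesssim> r * star s"
  using assms by (simp add: prec_mult prec_star)

section \<open>Cosets generated by sets\<close>

lemma upI: "x \<lesssim> y \<Longrightarrow> x \<in> T \<Longrightarrow> y \<in> S \<Longrightarrow> y \<in> up T"
  unfolding up_closure_def by blast

lemma upE:
  assumes "y \<in> up T"
  obtains x where "x \<in> T" "x \<lesssim> y" "y \<in> S"
  using assms unfolding up_closure_def by blast

lemma up_subset_S: "up T \<subseteq> S"
  unfolding up_closure_def by blast

lemma up_least: "T \<subseteq> up U \<Longrightarrow> up T \<subseteq> up U"
  unfolding up_closure_def using prec_trans by blast

lemma up_mono: "T \<subseteq> U \<Longrightarrow> up T \<subseteq> up U"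
  unfolding up_closure_def by blast

lemma mult_mem: "s \<in> T \<Longrightarrow> t \<in> U \<Longrightarrow> s * t \<in> T * (U :: 'a set)"
  by (rule set_times_intro)

lemma up_mult_subset: "up T * up U \<subseteq> up (T * U)"
  by (auto elim!: upE set_times_elim intro!: upI mult_mem prec_mult mult_S)

lemma star_up_subset: "star ` up T \<subseteq> up (star ` T)"
  by (auto elim!: upE intro!: upI prec_star star_S)

text \<open>Since \<open>\<precsim>\<close> is not reflexive, a set need not lie in its own upper closure; it is called round if it
  does, as then every element dominates some element of the set.  Upper closures of factors
  can be dropped under a further closure when the factors are round.\<close>

lemma up_mult_up:
  assumes "T \<subseteq> up T" "U \<subseteq> up U"
  shows "up (up T * up U) = up (T * U)"
  using up_least [OF up_mult_subset, of T U] up_mono [OF set_times_mono2 [OF assms]] by blast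

lemma star_up:
  assumes "T \<subseteq> S"
  shows "star ` up T = up (star ` T)"
proof
  show "up (star ` T) \<subseteq> star ` up T"
  proof
    fix y assume "y \<in> up (star ` T)"
    then have "star y \<in> star ` up (star ` T)"
      by blast
    then have "star y \<in> up (star ` star ` T)"
      using star_up_subset by blast
    then show "y \<in> star ` up T"
      by (simp add: image_image star_star) (metis star_star image_eqI)
  qed
qed (rule star_up_subset)

lemma round_star: "T \<subseteq> up T \<Longrightarrow> star ` T \<subseteq> up (star ` T)"
  using star_up_subset by blast

text \<open>Because \<open>up\<close> commutes with products and adjoints up to inclusion, both coset conditions need to be
  checked on generators only.\<close>

lemma is_coset_up:
  assumes round: "T \<subseteq> up T" and closed: "T * star ` T * T \<subseteq> up T"
  shows "is_coset S E (up T)"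
  unfolding is_coset_def
proof (intro conjI)
  show "up T \<subseteq> S"
    by (rule up_subset_S)
  have "up T * star ` up T * up T \<subseteq> up T * up (star ` T) * up T"
    by (intro set_times_mono2 star_up_subset subset_refl)
  also have "\<dots> \<subseteq> up (T * star ` T) * up T"
    by (intro set_times_mono2 up_mult_subset subset_refl)
  also have "\<dots> \<subseteq> up (T * star ` T * T)"
    by (rule up_mult_subset)
  also have "\<dots> \<subseteq> up T"
    by (rule up_least [OF closed])
  finally show "up T * star ` up T * up T \<subseteq> up T" .
  show "up T = up (up T)"
    using up_mono [OF round] up_least [of "up T" T] by blast
qed

lemma coset_subset_S: "is_coset S E C \<Longrightarrow> C \<subseteq> S"
  unfolding is_coset_def by blast

lemma coset_up: "is_coset S E C \<Longrightarrow> up C = C"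
  unfolding is_coset_def by blast

lemma coset_triple: "is_coset S E C \<Longrightarrow> x \<in> C \<Longrightarrow> y \<in> C \<Longrightarrow> z \<in> C \<Longrightarrow> x * star y * z \<in> C"
  unfolding is_coset_def by (blast intro: set_times_intro)

lemma coset_below:
  assumes "is_coset S E C" "x \<in> C"
  obtains y where "y \<in> C" "y \<lesssim> x"
  using assms coset_up upE by metis

lemma round_mult_cosets:
  assumes B: "is_coset S E B" and C: "is_coset S E C"
  shows "B * C \<subseteq> up (B * C)"
  using up_mult_subset [of B C] by (simp add: coset_up B C)

text \<open>A product \<open>b\<^sub>1c\<^sub>1(b\<^sub>2c\<^sub>2)\<^sup>*b\<^sub>3c\<^sub>3\<close> contains \<open>c\<^sub>1c\<^sub>2\<^sup>*\<close>, which composability allows to replace from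
  below by some \<open>p\<^sup>*q\<close> with \<open>p, q\<close> in \<open>B\<close>; what precedes \<open>c\<^sub>3\<close> is then in \<open>B\<close>.\<close>

lemma is_coset_mult:
  assumes B: "is_coset S E B" and C: "is_coset S E C" and comp: "coset_composable S E B C"
  shows "is_coset S E (coset_mult S E B C)"
  unfolding coset_mult_def
proof (rule is_coset_up)
  show "B * C \<subseteq> up (B * C)"
    using B C by (rule round_mult_cosets)
  show "B * C * star ` (B * C) * (B * C) \<subseteq> up (B * C)"
  proof
    fix x assume "x \<in> B * C * star ` (B * C) * (B * C)"
    then obtain b1 c1 b2 c2 b3 c3
      where b: "b1 \<in> B" "b2 \<in> B" "b3 \<in> B" and c: "c1 \<in> C" "c2 \<in> C" "c3 \<in> C"
        and "x = b1 * c1 * star (b2 * c2) * (b3 * c3)"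
      by (elim set_times_elim imageE) blast
    then have x: "x = b1 * (c1 * star c2) * (star b2 * b3) * c3"
      by (simp add: star_mult mult.assoc)
    have bS: "b1 \<in> S" "b2 \<in> S" "b3 \<in> S" and cS: "c1 \<in> S" "c2 \<in> S" "c3 \<in> S"
      using b c B C coset_subset_S by blast+
    obtain c1' c2' c3' where c': "c1' \<in> C" "c1' \<lesssim> c1" "c2' \<in> C" "c2' \<lesssim> c2" "c3' \<in> C" "c3' \<lesssim> c3"
      using c coset_below [OF C] by metis
    obtain b1' b2' b3' where b': "b1' \<in> B" "b1' \<lesssim> b1" "b2' \<in> B" "b2' \<lesssim> b2" "b3' \<in> B" "b3' \<lesssim> b3"
      using b coset_below [OF B] by metis
    have "c1' * star c2' \<lesssim> c1 * star c2" "c1' * star c2' \<in> C * star ` C"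
      using c' cS by (auto intro: prec_mult_star)
    then have "c1 * star c2 \<in> up (C * star ` C)"
      by (rule upI) (simp add: cS mult_S star_S)
    then have "c1 * star c2 \<in> up (star ` B * B)"
      using comp unfolding coset_composable_def by simp
    then obtain p q where pq: "p \<in> B" "q \<in> B" "star p * q \<lesssim> c1 * star c2"
      by (auto elim!: upE set_times_elim)
    have "b1' * (star p * q) * (star b2' * b3') * c3' \<lesssim> x"
      unfolding x using b' c' bS cS pq by (simp add: prec_mult prec_star mult_S star_S)
    moreover have "b1' * (star p * q) * (star b2' * b3') \<in> B"
      using coset_triple [OF B coset_triple [OF B b'(1) pq(1,2)] b'(3,5)] by (simp add: mult.assoc)
    then have "b1' * (star p * q) * (star b2' * b3') * c3' \<in> B * C"
      using c'(5) by (rule mult_mem)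
    ultimately show "x \<in> up (B * C)"
      by (rule upI) (simp add: x mult_S star_S bS cS)
  qed
qed

lemma coset_mult_in_cosets_containing:
  assumes B: "B \<in> cosets_containing S E a" and C: "C \<in> cosets_containing S E b"
    and comp: "coset_composable S E B C"
  shows "coset_mult S E B C \<in> cosets_containing S E (a * b)"
proof -
  have BC: "is_coset S E B" "is_coset S E C" "a \<in> B" "b \<in> C"
    using B C by (simp_all add: cosets_containing_def cosets_def)
  then have "a * b \<in> coset_mult S E B C"
    unfolding coset_mult_def using round_mult_cosets by blast
  moreover have "is_coset S E (coset_mult S E B C)"
    using is_coset_mult BC comp by blast
  ultimately show ?thesis
    by (auto simp: cosets_containing_def cosets_def)
qed

section \<open>Splitting a coset\<close>

text \<open>Put \<open>f = c\<^sup>*c\<close>.  Then \<open>fb\<^sup>*b = f\<close>, hence \<open>bf \<precsim> b\<close>, while \<open>Cf \<subseteq> C\<close>.  Every inclusion below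
  except \<open>C \<subseteq> (B1 B2)\<^sup>\<precsim>\<close> is proved in the same way: in a product of elements of \<open>C\<close>, \<open>C\<^sup>*\<close>, \<open>b\<close> and \<open>b\<^sup>*\<close>, replace each \<open>p\<close> in \<open>C\<close>
  by some \<open>g p \<precsim> p\<close> in \<open>C\<close>, each \<open>b\<close> by \<open>bf\<close> and each \<open>b\<^sup>*\<close> by \<open>fb\<^sup>*\<close>.  This gives a smaller element,
  in which every inner \<open>b\<^sup>*b\<close> is flanked by \<open>f\<close> and cancels.\<close>

lemma coset_split:
  assumes C: "is_coset S E C" and c: "c \<in> C" and b: "b \<in> S" and cb: "c * star b * b = c"
  defines "B1 \<equiv> {p * star b | p. p \<in> C}"
    and "B2 \<equiv> {b * star p * q | p q. p \<in> C \<and> q \<in> C}"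
  shows "is_coset S E (up B1)" "is_coset S E (up B2)" "b \<in> up B2"
    "coset_composable S E (up B1) (up B2)" "coset_mult S E (up B1) (up B2) = C"
proof -
  define f where "f = star c * c"
  have CS: "p \<in> S" if "p \<in> C" for p
    using that C coset_subset_S by blast
  have f_E: "f \<in> E"
    unfolding f_def using CS c star_mult_self_E by blast
  have f_star: "star f = f"
    by (simp add: f_def star_mult star_star)
  have f_cancel: "f * (star b * (b * t)) = f * t" for t
    using cb by (simp add: f_def mult.assoc) (simp flip: mult.assoc)
  have "f * (star b * b) = f"
    using cb by (simp add: f_def mult.assoc)
  then have bf_prec: "b * f \<lesssim> b"
    using conj_star_E [OF b f_E] by (simp add: weyl_prec_def mult.assoc)
  have fb_prec: "f * star b \<lesssim> star b"
    using prec_star [OF b bf_prec] by (simp add: star_mult f_star)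
  have Cf: "p * f \<in> C" if "p \<in> C" for p
    using coset_triple [OF C that c c] by (simp add: f_def mult.assoc)
  obtain g where gC: "\<And>p. p \<in> C \<Longrightarrow> g p \<in> C" and g: "\<And>p. p \<in> C \<Longrightarrow> g p \<lesssim> p"
  proof -
    have "\<forall>p\<in>C. \<exists>p'\<in>C. p' \<lesssim> p"
      by (blast elim: coset_below [OF C])
    then show thesis
      using that by metis
  qed
  note S_closed = mult_S star_S CS b
  have B1I: "p * star b \<in> B1" if "p \<in> C" for p
    using that B1_def by blast
  have B2I: "b * star p * q \<in> B2" if "p \<in> C" "q \<in> C" for p q
    using that B2_def by blast
  have round1: "B1 \<subseteq> up B1"
  proof
    fix x assume "x \<in> B1"
    then obtain p where p: "p \<in> C" and x: "x = p * star b"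
      unfolding B1_def by blast
    have "g p * (f * star b) \<lesssim> x"
      unfolding x using p fb_prec by (simp add: prec_mult g CS)
    moreover have "g p * (f * star b) \<in> B1"
      using B1I [OF Cf [OF gC [OF p(1)]]] by (simp add: mult.assoc)
    ultimately show "x \<in> up B1"
      by (rule upI) (use p in \<open>simp add: x S_closed\<close>)
  qed
  have round2: "B2 \<subseteq> up B2"
  proof
    fix x assume "x \<in> B2"
    then obtain p q where p: "p \<in> C" "q \<in> C" and x: "x = b * star p * q"
      unfolding B2_def by blast
    have "(b * f) * star (g p) * g q \<lesssim> x"
      unfolding x using p bf_prec by (simp add: prec_mult prec_star g S_closed)
    moreover have "(b * f) * star (g p) * g q = b * star (g p * f) * g q"
      by (simp add: star_mult f_star mult.assoc)
    then have "(b * f) * star (g p) * g q \<in> B2"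
      using B2I [OF Cf] gC p by simp
    ultimately show "x \<in> up B2"
      by (rule upI) (use p in \<open>simp add: x S_closed\<close>)
  qed
  have B1S: "B1 \<subseteq> S" and B2S: "B2 \<subseteq> S"
    by (auto simp: B1_def B2_def S_closed)
  show "is_coset S E (up B1)"
  proof (rule is_coset_up [OF round1])
    show "B1 * star ` B1 * B1 \<subseteq> up B1"
    proof
      fix x assume "x \<in> B1 * star ` B1 * B1"
      then obtain p q r where p: "p \<in> C" "q \<in> C" "r \<in> C"
        and x: "x = p * star b * (b * star q) * (r * star b)"
        unfolding B1_def by (auto elim!: set_times_elim simp: star_mult star_star)
      have "g p * (f * star b) * ((b * f) * star (g q)) * (g r * (f * star b)) \<lesssim> x"
        unfolding x using p bf_prec fb_prec by (simp add: prec_mult prec_star g S_closed)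
      moreover have "g p * (f * star b) * ((b * f) * star (g q)) * (g r * (f * star b))
          = (g p * f * f) * star (g q) * (g r * f) * star b"
        by (simp add: mult.assoc f_cancel)
      then have "g p * (f * star b) * ((b * f) * star (g q)) * (g r * (f * star b)) \<in> B1"
        using p by (auto intro!: B1I coset_triple [OF C] Cf gC)
      ultimately show "x \<in> up B1"
        by (rule upI) (use p in \<open>simp add: x S_closed\<close>)
    qed
  qed
  show "is_coset S E (up B2)"
  proof (rule is_coset_up [OF round2])
    show "B2 * star ` B2 * B2 \<subseteq> up B2"
    proof
      fix x assume "x \<in> B2 * star ` B2 * B2"
      then obtain p q r s t u where p: "p \<in> C" "q \<in> C" "r \<in> C" "s \<in> C" "t \<in> C" "u \<in> C"
        and "x = (b * star p * q) * star (b * star s * r) * (b * star t * u)"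
        unfolding B2_def by (elim set_times_elim imageE CollectE exE conjE) blast
      then have x: "x = (b * star p * q) * (star r * s * star b) * (b * star t * u)"
        by (simp add: star_mult star_star mult.assoc)
      let ?y = "((b * f) * star (g p) * g q) * (star (g r) * g s * (f * star b)) * ((b * f) * star (g t) * g u)"
      have "?y \<lesssim> x"
        unfolding x using p bf_prec fb_prec by (simp add: prec_mult prec_star g S_closed)
      moreover have "?y = b * star (g p * f) * (g q * star (g r) * (g s * f * f) * star (g t) * g u)"
        by (simp add: mult.assoc f_cancel star_mult f_star)
      then have "?y \<in> B2"
        using p by (auto intro!: B2I coset_triple [OF C] Cf gC)
      ultimately show "x \<in> up B2"
        by (rule upI) (use p in \<open>simp add: x S_closed\<close>)
    qed
  qed
  show "b \<in> up B2"
    using upI [OF _ B2I [OF c c] b] bf_prec by (simp add: f_def mult.assoc)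
  have "up (star ` up B1 * up B1) = up (star ` B1 * B1)"
    by (simp only: star_up [OF B1S] up_mult_up [OF round_star [OF round1] round1])
  also have "\<dots> = up (B2 * star ` B2)"
  proof
    show "up (star ` B1 * B1) \<subseteq> up (B2 * star ` B2)"
    proof (rule up_least, rule subsetI)
      fix x assume "x \<in> star ` B1 * B1"
      then obtain p q where p: "p \<in> C" "q \<in> C" and x: "x = b * star p * (q * star b)"
        unfolding B1_def by (auto elim!: set_times_elim simp: star_mult star_star)
      have "(b * f) * star (g p) * (g q * (f * star b)) \<lesssim> x"
        unfolding x using p bf_prec fb_prec by (simp add: prec_mult prec_star g S_closed)
      moreover have "(b * f) * star (g p) * (g q * (f * star b))
          = (b * star (g p * f) * g q) * star (b * star c * c)"
        by (simp add: f_def star_mult star_star mult.assoc)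
      then have "(b * f) * star (g p) * (g q * (f * star b)) \<in> B2 * star ` B2"
        using p c by (auto intro!: mult_mem imageI B2I Cf gC)
      ultimately show "x \<in> up (B2 * star ` B2)"
        by (rule upI) (use p in \<open>simp add: x S_closed\<close>)
    qed
    show "up (B2 * star ` B2) \<subseteq> up (star ` B1 * B1)"
    proof (rule up_least, rule subsetI)
      fix x assume "x \<in> B2 * star ` B2"
      then obtain p q r s where p: "p \<in> C" "q \<in> C" "r \<in> C" "s \<in> C"
        and "x = (b * star p * q) * star (b * star s * r)"
        unfolding B2_def by (elim set_times_elim imageE CollectE exE conjE) blast
      then have x: "x = (b * star p * q) * (star r * s * star b)"
        by (simp add: star_mult star_star mult.assoc)
      let ?y = "((b * f) * star (g p) * g q) * (star (g r) * g s * (f * star b))"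
      have "?y \<lesssim> x"
        unfolding x using p bf_prec fb_prec by (simp add: prec_mult prec_star g S_closed)
      moreover have "?y = star (g p * f * star b) * (g q * star (g r) * (g s * f) * star b)"
        by (simp add: mult.assoc star_mult star_star f_star)
      then have "?y \<in> star ` B1 * B1"
        using p by (auto intro!: mult_mem imageI B1I coset_triple [OF C] Cf gC)
      ultimately show "x \<in> up (star ` B1 * B1)"
        by (rule upI) (use p in \<open>simp add: x S_closed\<close>)
    qed
  qed
  also have "\<dots> = up (up B2 * star ` up B2)"
    by (simp only: star_up [OF B2S] up_mult_up [OF round2 round_star [OF round2]])
  finally show "coset_composable S E (up B1) (up B2)"
    unfolding coset_composable_def .
  have "up (up B1 * up B2) = up (B1 * B2)"
    by (rule up_mult_up [OF round1 round2])
  also have "\<dots> = up C"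
  proof
    show "up (B1 * B2) \<subseteq> up C"
    proof (rule up_least, rule subsetI)
      fix x assume "x \<in> B1 * B2"
      then obtain p q r where p: "p \<in> C" "q \<in> C" "r \<in> C"
        and x: "x = p * star b * (b * star q * r)"
        unfolding B1_def B2_def by (auto elim!: set_times_elim)
      have "g p * (f * star b) * ((b * f) * star (g q) * g r) \<lesssim> x"
        unfolding x using p bf_prec fb_prec by (simp add: prec_mult prec_star g S_closed)
      moreover have "g p * (f * star b) * ((b * f) * star (g q) * g r) = (g p * f * f) * star (g q) * g r"
        by (simp add: mult.assoc f_cancel)
      then have "g p * (f * star b) * ((b * f) * star (g q) * g r) \<in> C"
        using p by (auto intro!: coset_triple [OF C] Cf gC)
      ultimately show "x \<in> up C"
        by (rule upI) (use p in \<open>simp add: x S_closed\<close>)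
    qed
    show "up C \<subseteq> up (B1 * B2)"
    proof (rule up_least, rule subsetI)
      fix p assume p: "p \<in> C"
      \<comment> \<open>One \<open>f\<close> is kept in the factor from \<open>C\<^sup>*C\<close>, the other one cancels \<open>b\<^sup>*b\<close>.\<close>
      have "g p * (f * f) \<lesssim> p"
        using p by (intro prec_mult_E mult_E f_E g CS)
      moreover have "g p * (f * f) = (g p * f * star b) * (b * star c * c)"
        using f_cancel [of f] by (simp add: mult.assoc) (simp add: f_def mult.assoc)
      then have "g p * (f * f) \<in> B1 * B2"
        using p c by (auto intro!: mult_mem B1I B2I Cf gC)
      ultimately show "p \<in> up (B1 * B2)"
        by (rule upI) (use p in \<open>simp add: CS\<close>)
    qed
  qed
  finally show "coset_mult S E (up B1) (up B2) = C"
    unfolding coset_mult_def using coset_up [OF C] by simp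
qed

end

section \<open>Cancellation below a product, and the factorization\<close>

text \<open>The first claim is \<open>right_factor_acts_as_identity\<close>; applied to \<open>c\<^sup>* \<precsim> b\<^sup>*a\<^sup>*\<close> instead, the same
  lemma yields \<open>aa\<^sup>*c = c\<close>.  For the second claim put \<open>z = cb\<^sup>* - cb\<^sup>*a\<^sup>*a\<close>.  Then \<open>za\<^sup>* = 0\<close>, since \<open>aa\<^sup>*\<close>
  commutes with \<open>cb\<^sup>*a\<^sup>*\<close> and fixes \<open>c\<close> from the left, and \<open>zb = c - c = 0\<close>.  As \<open>z\<^sup>*\<close> is a difference of
  elements starting with \<open>b\<close> and with \<open>a\<^sup>*\<close>, this gives \<open>zz\<^sup>* = 0\<close>.\<close>

lemma prec_mult_right_cancel:
  fixes S E :: "'a::star_ring set"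
  assumes free: "star_infinitesimal_free TYPE('a)" and proper: "star_proper TYPE('a)"
    and weyl: "weyl_star_semigroup S E" and ball: "S \<subseteq> star_unit_ball"
    and S: "a \<in> S" "b \<in> S" "c \<in> S" and prec: "weyl_prec E c (a * b)"
  shows "c * star b * b = c" and "weyl_prec E (c * star b) a"
proof -
  interpret weyl S E
    using weyl by unfold_locales
  have ab: "c * star b * star a \<in> E" "c * star b * star a * a * b = c"
    using prec by (simp_all add: weyl_prec_def star_mult mult.assoc)
  show cb: "c * star b * b = c"
    using right_factor_acts_as_identity [OF free proper _ _ _ ab(2)] S ball by blast
  have "star c * star (star a) * star (star b) * star b * star a = star c"
    using prec_star [OF mult_S [OF S(1,2)] prec]
    by (simp add: weyl_prec_def star_mult star_star mult.assoc)
  then have "star c * star (star a) * star a = star c"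
    using right_factor_acts_as_identity [OF free proper _ _ _] S star_S ball by blast
  from arg_cong [OF this, of star] have ac: "a * star a * c = c"
    by (simp add: star_mult star_star mult.assoc)
  define z where "z = c * star b - c * star b * star a * a"
  have "a * star a * (c * star b * star a) = c * star b * star a"
    using ac by (simp flip: mult.assoc)
  then have "c * star b * star a * (a * star a) = c * star b * star a"
    by (simp only: mult_star_self_commute [OF S(1) ab(1)])
  then have za: "z * star a = 0"
    by (simp add: z_def left_diff_distrib mult.assoc)
  have "z * b = 0"
    using cb ab(2) by (simp add: z_def left_diff_distrib mult.assoc)
  then have zb: "z * (b * t) = 0" for t
    by (simp flip: mult.assoc)
  have za': "z * (star a * t) = 0" for t
    using za by (simp flip: mult.assoc)
  have "star z = b * star c - star a * (a * (b * star c))"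
    by (simp add: z_def star_diff star_mult star_star mult.assoc)
  then have "z * star z = 0"
    by (simp add: right_diff_distrib zb za')
  then have "z = 0"
    using proper unfolding star_proper_def by blast
  then show "weyl_prec E (c * star b) a"
    using ab(1) by (simp add: weyl_prec_def z_def)
qed

theorem theorem3p14:
  fixes S E :: "'a::star_ring set" and a b :: 'a
  assumes "star_archimedean TYPE('a)"
    and "star_infinitesimal_free TYPE('a)"
    and "star_proper TYPE('a)"
    and "weyl_star_semigroup S E"
    and "S \<subseteq> star_unit_ball"
    and "a \<in> S" and "b \<in> S"
  shows "cosets_containing S E (a * b) =
    coset_set_mult S E (cosets_containing S E a) (cosets_containing S E b)"
proof -
  interpret weyl S E
    using assms(4) by unfold_locales
  show ?thesis
  proof
    show "coset_set_mult S E (cosets_containing S E a) (cosets_containing S E b)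
        \<subseteq> cosets_containing S E (a * b)"
      unfolding coset_set_mult_def using coset_mult_in_cosets_containing by blast
    show "cosets_containing S E (a * b)
        \<subseteq> coset_set_mult S E (cosets_containing S E a) (cosets_containing S E b)"
    proof
      fix C assume "C \<in> cosets_containing S E (a * b)"
      then have C: "is_coset S E C" and "a * b \<in> C"
        by (simp_all add: cosets_containing_def cosets_def)
      then obtain c where c: "c \<in> C" "weyl_prec E c (a * b)"
        using coset_below by blast
      have "c \<in> S"
        using C c coset_subset_S by blast
      note c_props = prec_mult_right_cancel [OF assms(2-7) this c(2)]
      let ?B1 = "up {p * star b | p. p \<in> C}"
      let ?B2 = "up {b * star p * q | p q. p \<in> C \<and> q \<in> C}"
      note split = coset_split [OF C c(1) assms(7) c_props(1)]
      have "a \<in> ?B1"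
        using c(1) c_props(2) assms(6) by (blast intro: upI)
      then have "?B1 \<in> cosets_containing S E a" "?B2 \<in> cosets_containing S E b"
        using split(1-3) by (auto simp: cosets_containing_def cosets_def)
      then show "C \<in> coset_set_mult S E (cosets_containing S E a) (cosets_containing S E b)"
        unfolding coset_set_mult_def using split(4,5) by blast
    qed
  qed
qed

end
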